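(* Let $\mathcal{I}\subset[0,1]$ be a compact set satisfying $\dim_{\mathcal H}(\mathcal I)=\dim_{u\text{-}box}(\mathcal I)>0$, and for each integer $j\ge 0$ let $\mathcal I_j$ denote the set of dyadic intervals of size $2^{-j}$ that intersect $\mathcal I$. Let $\varepsilon>0$ and $b\in(0,1)$. Then there exist a set $\mathcal K_\varepsilon(b)\subset\mathcal I$ and integers $J\ge 1$, $\ell_0\ge 0$ such that: 1. $\dim_{\mathcal H}(\mathcal I)-\varepsilon\le\dim_{\mathcal H}(\mathcal K_\varepsilon(b))\le\dim_{\mathcal H}(\mathcal I)$; 2. for all $j=\lfloor(1+b)^\ell J\rfloor$ with $\ell\ge\ell_0$, $$2^{j(\dim_{\mathcal H}(\mathcal I)-\varepsilon)}\le\#\{\lambda\in\mathcal I_j:\lambda\cap\mathcal K_\varepsilon(b)\ne\emptyset\}\le2^{j(\dim_{\mathcal H}(\mathcal I)+\varepsilon)};$$ 3. for each $\lambda\in\mathcal I_j$ such that $\lambda\cap\mathcal K_\varepsilon(b)\neq\emptyset$, with $j=\lfloor(1+b)^\ell J\rfloor$ and $\ell\ge\ell_0$, and for any integer $\ell'\ge1$, $$\#\{\lambda'\in\mathcal I_{\lfloor(1+b)^{\ell+\ell'}J\rfloor}:\lambda'\subset\lambda,\ \lambda'\cap\mathcal K_\varepsilon(b)\ne\emptyset\}\ge2^{((1+b)^{\ell'}-1)(1+b)^\ell J\left(\dim_{\mathcal H}(\mathcal I)-\frac{5\varepsilon}{b}\right)}.$$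
   Context: $\dim_{\mathcal H}$ is the Hausdorff dimension. The upper-box dimension of $\mathcal I\subset\mathbb R$ is $\dim_{u\text{-}box}(\mathcal I)=\limsup_{r\to0}\frac{\log N(r)}{-\log r}$, where $N(r)$ is the smallest number of intervals of length $r$ which can cover $\mathcal I$. A dyadic interval of size $2^{-j}$ is an interval $[k2^{-j},(k+1)2^{-j})$ with $k\in\mathbb Z$. *)

theory Defs
  imports "HOL-Analysis.Analysis"
begin

text \<open>The clause \<open>bounded (U n)\<close> is needed because \<^const>\<open>diameter\<close> is only meaningful on bounded sets.\<close>

definition hausdorff_content :: "real \<Rightarrow> real \<Rightarrow> 'a::metric_space set \<Rightarrow> ennreal" where
  "hausdorff_content s \<delta> A =
     Inf {(\<Sum>n. ennreal (diameter (U n) powr s)) | U :: nat \<Rightarrow> 'a set.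
            A \<subseteq> (\<Union>n. U n) \<and> (\<forall>n. bounded (U n) \<and> diameter (U n) \<le> \<delta>)}"

definition hausdorff_measure :: "real \<Rightarrow> 'a::metric_space set \<Rightarrow> ennreal" where
  "hausdorff_measure s A = (SUP \<delta>\<in>{0<..}. hausdorff_content s \<delta> A)"

text \<open>
  The exponent \<open>s = 0\<close> is left out because \<open>0 powr 0 = 0\<close> would give one-point sets the wrong
  0-dimensional measure; this does not change the infimum. For sets of reals the infimum ranges
  over a nonempty set (see \<open>hausdorff_dim_wellformed\<close> below), so it is a genuine real number.
\<close>

definition hausdorff_dim :: "real set \<Rightarrow> real" where
  "hausdorff_dim A = Inf {s. 0 < s \<and> hausdorff_measure s A = 0}"

text \<open>
  Covering by closed intervals gives the same number as covering by arbitrary intervals of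
  length \<open>r\<close>. The set \<open>C\<close> collects the left endpoints. Meaningful for bounded \<open>A\<close> and \<open>r > 0\<close>.
\<close>

definition covering_number :: "real set \<Rightarrow> real \<Rightarrow> nat" where
  "covering_number A r =
     (LEAST n. \<exists>C. finite C \<and> card C = n \<and> A \<subseteq> (\<Union>c\<in>C. {c..c + r}))"

definition upper_box_dim :: "real set \<Rightarrow> ereal" where
  "upper_box_dim A =
     Limsup (at_right 0) (\<lambda>r. ereal (ln (real (covering_number A r)) / - ln r))"

definition dyadic_intervals :: "nat \<Rightarrow> real set set" where
  "dyadic_intervals j = range (\<lambda>k::int. {of_int k / 2 ^ j ..< (of_int k + 1) / 2 ^ j})"

definition dyadic_meeting :: "real set \<Rightarrow> nat \<Rightarrow> real set set" where
  "dyadic_meeting A j = {Q \<in> dyadic_intervals j. Q \<inter> A \<noteq> {}}"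

definition geom_scale :: "real \<Rightarrow> nat \<Rightarrow> nat \<Rightarrow> nat" where
  "geom_scale b J l = nat \<lfloor>(1 + b) ^ l * real J\<rfloor>"

lemma real_line_small_cover:
  fixes c :: real
  assumes c: "0 < c"
  defines "U \<equiv> (\<lambda>n. cball (c * (-1) ^ n * harm n) (2 * c / real (Suc n)))"
  shows "(\<Union>n. U n) = UNIV"
proof -
  have "\<exists>n. x \<in> U n" for x :: real
  proof -
    have "filterlim (\<lambda>n. harm n :: real) at_top sequentially"
      by (rule harm_at_top)
    then have "eventually (\<lambda>n. harm n > \<bar>x\<bar> / c) sequentially"
      by (simp add: filterlim_at_top_dense)
    then obtain n0 where n0: "harm n0 > \<bar>x\<bar> / c"
      by (auto simp: eventually_sequentially)
    define M where "M = (LEAST n. harm n > \<bar>x\<bar> / c)"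
    have M: "harm M > \<bar>x\<bar> / c"
      unfolding M_def by (rule LeastI) (rule n0)
    have "M \<noteq> 0"
      using M c by (intro notI) (simp add: harm_def divide_less_0_iff)
    then obtain m where m: "M = Suc m"
      by (cases M) auto
    have "\<not> harm m > \<bar>x\<bar> / c"
      using not_less_Least[of m "\<lambda>n. harm n > \<bar>x\<bar> / c"] m unfolding M_def by simp
    then have lo: "c * harm m \<le> \<bar>x\<bar>"
      using c by (simp add: field_simps)
    have hi: "\<bar>x\<bar> < c * harm (Suc m)"
      using M m c by (simp add: field_simps)
    have step: "c * harm (Suc m) = c * harm m + c / real (Suc m)"
      by (simp add: harm_Suc field_simps)
    have b1: "c / real (Suc m) \<le> 2 * c / real (Suc m)"
      using c by (simp add: field_simps)
    have b2: "c / real (Suc m) \<le> 2 * c / real (Suc (Suc m))"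
      using c by (simp add: field_simps)
    define n where "n = (if even m = (0 \<le> x) then m else Suc m)"
    have sg: "(-1) ^ n = (if 0 \<le> x then 1 else -1 :: real)"
      by (auto simp: n_def)
    have "\<bar>c * harm n - \<bar>x\<bar>\<bar> \<le> 2 * c / real (Suc n)"
    proof (cases "even m = (0 \<le> x)")
      case True
      then have "n = m" by (simp add: n_def)
      then show ?thesis using lo hi step b1 by simp
    next
      case False
      then have "n = Suc m" by (simp add: n_def)
      then show ?thesis using lo hi step b2 by simp
    qed
    then have "x \<in> U n"
      unfolding U_def by (cases "0 \<le> x") (auto simp: sg dist_real_def abs_if split: if_splits)
    then show ?thesis by blast
  qed
  then show ?thesis by blast
qed

lemma hausdorff_measure_2_real:
  fixes A :: "real set"
  shows "hausdorff_measure 2 A = 0"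
proof -
  have summ: "summable (\<lambda>n. inverse (real (Suc n) ^ 2))"
    using inverse_power_summable[of 2, where 'a = real]
      summable_Suc_iff[of "\<lambda>n. inverse (real n ^ 2)"] by simp
  define S where "S = (\<Sum>n. inverse (real (Suc n) ^ 2))"
  have S0: "0 \<le> S" unfolding S_def by (rule suminf_nonneg[OF summ]) simp
  have le: "hausdorff_content 2 \<delta> A \<le> ennreal (16 * c\<^sup>2 * S)"
    if c: "0 < c" "4 * c \<le> \<delta>" for \<delta> c
  proof -
    define U where "U = (\<lambda>n. cball (c * (-1) ^ n * harm n) (2 * c / real (Suc n)))"
    have cov: "A \<subseteq> (\<Union>n. U n)"
      using real_line_small_cover[OF c(1)] unfolding U_def by simp
    have diam: "diameter (U n) = 4 * c / real (Suc n)" for n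
      unfolding U_def using c divide_nonneg_nonneg[of "2 * c" "real (Suc n)"] by (auto simp: diameter_cball not_less)
    have "4 * c / real (Suc n) \<le> 4 * c" for n
      using c by (simp add: field_simps)
    then have small: "bounded (U n) \<and> diameter (U n) \<le> \<delta>" for n
      using diam[of n] c(2) order_trans by (fastforce simp: U_def)
    have "hausdorff_content 2 \<delta> A \<le> (\<Sum>n. ennreal (diameter (U n) powr 2))"
      unfolding hausdorff_content_def using cov small by (intro Inf_lower) blast
    also have "\<dots> = (\<Sum>n. ennreal (16 * c\<^sup>2 * inverse (real (Suc n) ^ 2)))"
      using c by (intro arg_cong[of _ _ suminf] ext)
        (simp add: diam powr_numeral power_divide power_mult_distrib divide_inverse power_inverse del: of_nat_Suc)
    also have "\<dots> = ennreal (\<Sum>n. 16 * c\<^sup>2 * inverse (real (Suc n) ^ 2))"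
      using summ by (intro suminf_ennreal2 summable_mult) auto
    also have "(\<Sum>n. 16 * c\<^sup>2 * inverse (real (Suc n) ^ 2)) = 16 * c\<^sup>2 * S"
      unfolding S_def by (rule suminf_mult[OF summ])
    finally show ?thesis .
  qed
  have "hausdorff_content 2 \<delta> A = 0" if \<delta>: "0 < \<delta>" for \<delta>
  proof -
    have "((\<lambda>c. ennreal (16 * c\<^sup>2 * S)) \<longlongrightarrow> ennreal (16 * 0\<^sup>2 * S)) (at_right 0)"
      by (intro tendsto_intros)
    moreover have "eventually (\<lambda>c. hausdorff_content 2 \<delta> A \<le> ennreal (16 * c\<^sup>2 * S)) (at_right 0)"
      using \<delta> by (auto simp: eventually_at_right_field intro!: exI[of _ "\<delta> / 4"] le)
    ultimately have "hausdorff_content 2 \<delta> A \<le> ennreal (16 * 0\<^sup>2 * S)"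
      by (intro tendsto_lowerbound) auto
    then show ?thesis by simp
  qed
  then show ?thesis unfolding hausdorff_measure_def by simp
qed

lemma hausdorff_dim_wellformed:
  "{s. 0 < s \<and> hausdorff_measure s (A :: real set) = 0} \<noteq> {}"
  "bdd_below {s. 0 < s \<and> hausdorff_measure s (A :: real set) = 0}"
  using hausdorff_measure_2_real[of A] by (auto intro!: exI[of _ 2] bdd_belowI[of _ 0])

end

theory Submission
  imports Defs
begin

text \<open>
  Take \<open>J = 1\<close>, let \<open>d\<close> be the dimension and \<open>0 < e \<le> \<epsilon> / 2\<close> with
  \<open>5 e < b d\<close>. Prune the tree of dyadic intervals at the scales \<open>\<lfloor>(1 + b)\<^sup>l\<rfloor>\<close>: an
  interval at level \<open>l\<close> is bad once fewer than \<open>t\<^sub>l = 2 powr ((1 + b)\<^sup>l (b d - 5 e))\<close> of its children are not yet known to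
  be bad. A point outside the pruned set lies in one of the fewer than \<open>t\<^sub>l\<close> children with which some
  bad interval is left when it is discarded. There are at most \<open>2 powr ((1 + b)\<^sup>l (d + e))\<close> intervals at
  level \<open>l\<close> by the box dimension, so the \<open>(d - e)\<close>-dimensional content lost at level \<open>l\<close> is of order
  \<open>2 powr (- 2 e (1 + b)\<^sup>l)\<close>. Starting the pruning late, the total loss is smaller than the content of
  the original set. The one-step branching bounds multiply, and the exponents telescope.
\<close>

subsection \<open>Hausdorff content\<close>

lemma hausdorff_content_mono:
  "A \<subseteq> B \<Longrightarrow> hausdorff_content s \<delta> A \<le> hausdorff_content s \<delta> B"
  unfolding hausdorff_content_def by (intro Inf_superset_mono) blast

lemma hausdorff_content_antimono_scale:
  "\<delta> \<le> \<delta>' \<Longrightarrow> hausdorff_content s \<delta>' A \<le> hausdorff_content s \<delta> A"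
  unfolding hausdorff_content_def by (intro Inf_superset_mono) (blast intro: order_trans)

lemma hausdorff_measure_mono:
  "A \<subseteq> B \<Longrightarrow> hausdorff_measure s A \<le> hausdorff_measure s B"
  unfolding hausdorff_measure_def by (intro SUP_mono') (rule hausdorff_content_mono)

text \<open>All diameters are at most 1, so a larger exponent makes each term of a cover sum
  smaller. Zero diameters contribute 0 for either exponent, by \<open>0 powr s = 0\<close>.\<close>

lemma hausdorff_content_antimono_exponent:
  assumes "s \<le> t" "\<delta> \<le> 1"
  shows "hausdorff_content t \<delta> A \<le> hausdorff_content s \<delta> A"
  unfolding hausdorff_content_def
proof (rule Inf_mono, clarify)
  fix U :: "nat \<Rightarrow> 'a set"
  assume U: "A \<subseteq> (\<Union>n. U n)" "\<forall>n. bounded (U n) \<and> diameter (U n) \<le> \<delta>"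
  have "diameter (U n) powr t \<le> diameter (U n) powr s" for n
    using assms U(2) diameter_ge_0[of "U n"] order_trans[of "diameter (U n)" \<delta> 1]
    by (cases "diameter (U n) = 0") (auto intro: powr_mono')
  then have "(\<Sum>n. ennreal (diameter (U n) powr t)) \<le> (\<Sum>n. ennreal (diameter (U n) powr s))"
    by (intro suminf_le) (auto intro: ennreal_leI)
  with U show "\<exists>a\<in>{\<Sum>n. ennreal (diameter (U n) powr t) |U.
       A \<subseteq> \<Union> (range U) \<and> (\<forall>n. bounded (U n) \<and> diameter (U n) \<le> \<delta>)}.
       a \<le> (\<Sum>n. ennreal (diameter (U n) powr s))" by blast
qed

text \<open>Near-optimal covers with errors \<open>e * (1/2) ^ Suc n\<close> are merged into a
  single sequence. A piece of infinite content makes the bound trivial and has to be split off,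
  because no cover then gets strictly below content plus error.\<close>

lemma hausdorff_content_UN_le:
  "hausdorff_content s \<delta> (\<Union>n. A n) \<le> (\<Sum>n. hausdorff_content s \<delta> (A n))"
proof (cases "\<exists>n. hausdorff_content s \<delta> (A n) = \<infinity>")
  case True
  then obtain n where n: "hausdorff_content s \<delta> (A n) = \<infinity>" ..
  have "hausdorff_content s \<delta> (A n) \<le> (\<Sum>n. hausdorff_content s \<delta> (A n))"
    using sum_le_suminf[of "\<lambda>n. hausdorff_content s \<delta> (A n)" "{n}"] by simp
  then show ?thesis using n by (simp add: top_unique)
next
  case False
  show ?thesis
  proof (rule ennreal_le_epsilon)
    fix e :: real assume e: "0 < e"
    have "\<exists>U. A n \<subseteq> (\<Union>i. U i) \<and> (\<forall>i. bounded (U i) \<and> diameter (U i) \<le> \<delta>) \<and>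
        (\<Sum>i. ennreal (diameter (U i) powr s)) < hausdorff_content s \<delta> (A n) + ennreal (e * (1/2) ^ Suc n)"
      for n
    proof -
      have "hausdorff_content s \<delta> (A n) < hausdorff_content s \<delta> (A n) + ennreal (e * (1/2) ^ Suc n)"
        using False e by (simp add: ennreal_add_left_cancel_less less_top)
      then show ?thesis
        unfolding hausdorff_content_def[of s \<delta> "A n"] Inf_less_iff by blast
    qed
    then obtain U where U: "\<And>n. A n \<subseteq> (\<Union>i. U n i)"
        "\<And>n i. bounded (U n i) \<and> diameter (U n i) \<le> \<delta>"
        "\<And>n. (\<Sum>i. ennreal (diameter (U n i) powr s))
                < hausdorff_content s \<delta> (A n) + ennreal (e * (1/2) ^ Suc n)"
      by metis
    \<comment> \<open>Enumeration of the double family along the pairing of the naturals.\<close>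
    define V where "V i = case_prod U (prod_decode i)" for i
    have "(\<Union>n. A n) \<subseteq> (\<Union>i. V i)"
    proof
      fix x assume "x \<in> (\<Union>n. A n)"
      then obtain n i where "x \<in> U n i" using U(1) by blast
      then have "x \<in> V (prod_encode (n, i))" by (simp add: V_def)
      then show "x \<in> (\<Union>i. V i)" by blast
    qed
    moreover have "bounded (V i) \<and> diameter (V i) \<le> \<delta>" for i
      using U(2) by (auto simp: V_def split: prod.split)
    ultimately have "hausdorff_content s \<delta> (\<Union>n. A n) \<le> (\<Sum>i. ennreal (diameter (V i) powr s))"
      unfolding hausdorff_content_def by (intro Inf_lower) blast
    also have "\<dots> = (\<Sum>n. \<Sum>i. ennreal (diameter (U n i) powr s))"
      unfolding V_def
      by (subst suminf_ennreal_2dimen[where f = "\<lambda>p. ennreal (diameter (case_prod U p) powr s)", symmetric])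
        simp_all
    also have "\<dots> \<le> (\<Sum>n. hausdorff_content s \<delta> (A n) + ennreal (e * (1/2) ^ Suc n))"
      using U(3) by (intro suminf_le less_imp_le) auto
    also have "\<dots> = (\<Sum>n. hausdorff_content s \<delta> (A n)) + (\<Sum>n. ennreal (e * (1/2) ^ Suc n))"
      by (simp add: suminf_add)
    also have "(\<Sum>n. ennreal (e * (1/2) ^ Suc n)) = ennreal e"
    proof -
      have "(\<lambda>n. e * (1/2) ^ Suc n) sums (e * 1)"
        by (intro sums_mult power_half_series)
      then show ?thesis using e by (intro suminf_ennreal_eq) auto
    qed
    finally show "hausdorff_content s \<delta> (\<Union>n. A n)
        \<le> (\<Sum>n. hausdorff_content s \<delta> (A n)) + ennreal e" .
  qed
qed

lemma hausdorff_content_empty: "0 \<le> \<delta> \<Longrightarrow> hausdorff_content s \<delta> {} = 0"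
  unfolding hausdorff_content_def
  by (rule antisym[OF Inf_lower2[of 0]]) (auto intro!: exI[of _ "\<lambda>_. {}"])

lemma hausdorff_content_Un_le:
  assumes "0 \<le> \<delta>"
  shows "hausdorff_content s \<delta> (A \<union> B) \<le> hausdorff_content s \<delta> A + hausdorff_content s \<delta> B"
proof -
  \<comment> \<open>Padding with empty sets, which have content 0 once \<delta> is
    nonnegative.\<close>
  let ?F = "\<lambda>n::nat. if n = 0 then A else if n = 1 then B else {}"
  have "(\<Union>n. ?F n) = A \<union> B" by (auto split: if_splits)
  then have "hausdorff_content s \<delta> (A \<union> B) \<le> (\<Sum>n. hausdorff_content s \<delta> (?F n))"
    using hausdorff_content_UN_le[of s \<delta> ?F] by simp
  also have "\<dots> = (\<Sum>n\<in>{0, 1}. hausdorff_content s \<delta> (?F n))"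
    using assms by (intro suminf_finite) (auto simp: hausdorff_content_empty)
  finally show ?thesis by simp
qed

lemma hausdorff_content_le_diameter:
  assumes "bounded A" "diameter A \<le> \<delta>" "0 \<le> \<delta>"
  shows "hausdorff_content s \<delta> A \<le> ennreal (diameter A powr s)"
proof -
  let ?U = "\<lambda>n::nat. if n = 0 then A else {}"
  have "(\<Sum>n. ennreal (diameter (?U n) powr s)) = (\<Sum>n\<in>{0}. ennreal (diameter (?U n) powr s))"
    by (intro suminf_finite) auto
  moreover have "hausdorff_content s \<delta> A \<le> (\<Sum>n. ennreal (diameter (?U n) powr s))"
    unfolding hausdorff_content_def using assms by (intro Inf_lower CollectI exI[of _ ?U]) auto
  ultimately show ?thesis by simp
qed

text \<open>Each member serves as its own cover. The equal diameters fit a family of dyadic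
  intervals of one generation, so counting intervals bounds content.\<close>

lemma hausdorff_content_Union_le:
  assumes "finite F" "0 \<le> \<delta>" "\<delta>' \<le> \<delta>"
    and "\<And>U. U \<in> F \<Longrightarrow> bounded U \<and> diameter U = \<delta>'"
  shows "hausdorff_content s \<delta> (\<Union>F) \<le> ennreal (real (card F) * \<delta>' powr s)"
  using assms(1,4)
proof (induction F)
  case empty
  then show ?case using assms(2) by (simp add: hausdorff_content_empty)
next
  case (insert U F)
  have "hausdorff_content s \<delta> (\<Union>(insert U F)) \<le> hausdorff_content s \<delta> U + hausdorff_content s \<delta> (\<Union>F)"
    using hausdorff_content_Un_le[OF assms(2)] by simp
  also have "\<dots> \<le> ennreal (\<delta>' powr s) + ennreal (real (card F) * \<delta>' powr s)"
    using hausdorff_content_le_diameter[of U \<delta> s] insert assms(2,3) by (intro add_mono) auto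
  also have "\<dots> = ennreal (real (card (insert U F)) * \<delta>' powr s)"
    using insert(1,2) by (simp add: algebra_simps flip: ennreal_plus)
  finally show ?case .
qed

section \<open>Dimension and positive content at one scale\<close>

lemma hausdorff_dim_mono: "A \<subseteq> B \<Longrightarrow> hausdorff_dim A \<le> hausdorff_dim B"
  unfolding hausdorff_dim_def
  by (rule cInf_superset_mono[OF hausdorff_dim_wellformed])
    (use hausdorff_measure_mono[of A B] in \<open>auto simp flip: le_zero_eq intro: order_trans\<close>)

text \<open>The measure is a supremum of contents, so one of them is positive. Passing to a smaller
  scale can only increase it, which allows \<delta> to be capped at 1.\<close>

lemma hausdorff_content_pos_of_less_dim:
  assumes "0 < s" "s < hausdorff_dim A"
  shows "\<exists>\<delta>. 0 < \<delta> \<and> \<delta> \<le> 1 \<and> 0 < hausdorff_content s \<delta> A"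
proof -
  have "hausdorff_measure s A \<noteq> 0"
    using assms cInf_lower[OF _ hausdorff_dim_wellformed(2), of s A] unfolding hausdorff_dim_def by force
  then have "0 < hausdorff_measure s A" by (simp add: zero_less_iff_neq_zero)
  then obtain \<delta> where \<delta>: "0 < \<delta>" "0 < hausdorff_content s \<delta> A"
    unfolding hausdorff_measure_def less_SUP_iff by auto
  then have "0 < hausdorff_content s (min \<delta> 1) A"
    using hausdorff_content_antimono_scale[of "min \<delta> 1" \<delta> s A] by (auto intro: less_le_trans)
  with \<delta>(1) show ?thesis by (intro exI[of _ "min \<delta> 1"]) auto
qed

text \<open>For \<open>t < s\<close> and scale at most 1, the content with exponent \<open>t\<close>
  dominates the one with exponent \<open>s\<close>, so the measure with exponent \<open>t\<close>
  cannot vanish. One scale thus suffices for a lower bound on the dimension.\<close>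

lemma hausdorff_dim_ge_of_content_pos:
  assumes "0 < \<delta>" "\<delta> \<le> 1" "0 < hausdorff_content s \<delta> A"
  shows "s \<le> hausdorff_dim A"
  unfolding hausdorff_dim_def
proof (rule cInf_greatest[OF hausdorff_dim_wellformed(1)], clarify, rule ccontr)
  fix t assume t: "0 < t" "hausdorff_measure t A = 0" "\<not> s \<le> t"
  have "hausdorff_content s \<delta> A \<le> hausdorff_content t \<delta> A"
    using t(3) assms(2) by (intro hausdorff_content_antimono_exponent) auto
  also have "\<dots> \<le> hausdorff_measure t A"
    unfolding hausdorff_measure_def using assms(1) by (intro SUP_upper) auto
  finally show False using t(2) assms(3) by simp
qed

subsection \<open>Dyadic intervals\<close>

lemma dyadic_intervals_subset:
  assumes "Q \<in> dyadic_intervals i" "R \<in> dyadic_intervals j" "i \<le> j" "Q \<inter> R \<noteq> {}"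
  shows "R \<subseteq> Q"
proof -
  obtain k m :: int where Q: "Q = {of_int k / 2 ^ i ..< (of_int k + 1) / 2 ^ i}"
    and R: "R = {of_int m / 2 ^ j ..< (of_int m + 1) / 2 ^ j}"
    using assms unfolding dyadic_intervals_def by blast
  obtain x where x: "x \<in> Q" "x \<in> R" using assms by blast
  define n :: int where "n = 2 ^ (j - i)"
  have j: "(2::real) ^ j = 2 ^ i * of_int n"
    using assms(3) by (simp add: n_def flip: power_add)
  have n: "0 < n" by (simp add: n_def)
  have x1: "of_int k \<le> x * 2 ^ i" "x * 2 ^ i < of_int k + 1"
    using x(1) by (auto simp: Q field_simps)
  have x2: "of_int m \<le> x * 2 ^ j" "x * 2 ^ j < of_int m + 1"
    using x(2) by (auto simp: R field_simps)
  have "real_of_int (k * n) \<le> x * 2 ^ j" "x * 2 ^ j < of_int ((k + 1) * n)"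
    using x1 n by (auto simp: j simp flip: mult.assoc)
  then have "real_of_int (k * n) < of_int (m + 1)" "real_of_int m < of_int ((k + 1) * n)"
    using x2 by linarith+
  \<comment> \<open>After scaling by \<open>2 ^ j\<close> all endpoints are integers, so the strict
    inequalities gain a full unit.\<close>
  then have "k * n \<le> m" "m + 1 \<le> (k + 1) * n"
    unfolding of_int_less_iff by linarith+
  then have "real_of_int (k * n) \<le> of_int m" "real_of_int (m + 1) \<le> of_int ((k + 1) * n)"
    unfolding of_int_le_iff .
  then have "of_int k / 2 ^ i \<le> (of_int m / 2 ^ j :: real)"
    "(of_int m + 1) / 2 ^ j \<le> ((of_int k + 1) / 2 ^ i :: real)"
    using n mult_right_mono[of "of_int (m + 1)" "of_int ((k + 1) * n)" "2 ^ i :: real"]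
    by (simp_all add: j field_simps)
  then show ?thesis unfolding Q R by (auto simp: subset_iff)
qed

lemma dyadic_intervals_eq:
  "Q \<in> dyadic_intervals j \<Longrightarrow> R \<in> dyadic_intervals j \<Longrightarrow> Q \<inter> R \<noteq> {} \<Longrightarrow> Q = R"
  using dyadic_intervals_subset[of Q j R j] dyadic_intervals_subset[of R j Q j] by blast

lemma dyadic_intervals_cover: "\<exists>Q\<in>dyadic_intervals j. x \<in> Q"
proof -
  have "x \<in> {of_int \<lfloor>x * 2 ^ j\<rfloor> / 2 ^ j ..< (of_int \<lfloor>x * 2 ^ j\<rfloor> + 1) / 2 ^ j}"
    using of_int_floor_le[of "x * 2 ^ j"] floor_correct[of "x * 2 ^ j"] by (auto simp: field_simps)
  then show ?thesis unfolding dyadic_intervals_def by blast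
qed

lemma bounded_dyadic_intervals: "Q \<in> dyadic_intervals j \<Longrightarrow> bounded Q"
  by (auto simp: dyadic_intervals_def)

lemma diameter_dyadic_intervals:
  assumes "Q \<in> dyadic_intervals j"
  shows "diameter Q = 1 / 2 ^ j"
proof -
  obtain k :: int where Q: "Q = {of_int k / 2 ^ j ..< (of_int k + 1) / 2 ^ j}"
    using assms unfolding dyadic_intervals_def by blast
  have "of_int k / 2 ^ j < ((of_int k + 1) / 2 ^ j :: real)"
    by (simp add: divide_strict_right_mono)
  then have "closure Q = {of_int k / 2 ^ j .. (of_int k + 1) / 2 ^ j}"
    unfolding Q by (rule closure_atLeastLessThan)
  then have "diameter (closure Q) = 1 / 2 ^ j"
    by (simp add: field_simps)
  then show ?thesis
    by (simp add: diameter_closure bounded_dyadic_intervals[OF assms])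
qed

text \<open>Closing an interval adds only its right endpoint. For the left one of the two, this
  endpoint does not exceed the left endpoint of the other, which still lies in
  \<open>Q\<close>.\<close>

lemma dyadic_closure_subset:
  assumes Q: "Q \<in> dyadic_intervals i" and R: "R \<in> dyadic_intervals j" "R' \<in> dyadic_intervals j"
    "R \<noteq> R'" "R \<subseteq> Q" "R' \<subseteq> Q"
  shows "closure R \<subseteq> Q \<or> closure R' \<subseteq> Q"
proof -
  have *: "closure {of_int m / 2 ^ j ..< (of_int m + 1) / 2 ^ j :: real} \<subseteq> Q"
    if "m < n" "{of_int m / 2 ^ j ..< (of_int m + 1) / 2 ^ j} \<subseteq> Q"
      "{of_int n / 2 ^ j ..< (of_int n + 1) / 2 ^ j} \<subseteq> Q" for m n :: int
  proof -
    obtain k :: int where k: "Q = {of_int k / 2 ^ i ..< (of_int k + 1) / 2 ^ i}"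
      using Q unfolding dyadic_intervals_def by blast
    have lt: "of_int m / 2 ^ j < ((of_int m + 1) / 2 ^ j :: real)" for m
      by (simp add: divide_strict_right_mono)
    have "of_int m / 2 ^ j \<in> Q" "of_int n / 2 ^ j \<in> Q"
      using that(2,3) lt[of m] lt[of n] by auto
    moreover have "(of_int m + 1) / 2 ^ j \<le> (of_int n / 2 ^ j :: real)"
      using that(1) by (intro divide_right_mono) auto
    ultimately show ?thesis
      unfolding closure_atLeastLessThan[OF lt] by (auto simp: k)
  qed
  obtain m n where mn: "R = {of_int m / 2 ^ j ..< (of_int m + 1) / 2 ^ j}"
    "R' = {of_int n / 2 ^ j ..< (of_int n + 1) / 2 ^ j}"
    using R unfolding dyadic_intervals_def by blast
  with R(3) have "m < n \<or> n < m" by (auto simp: neq_iff)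
  then show ?thesis using *[of m n] *[of n m] R mn by blast
qed

section \<open>Counting dyadic intervals that meet a bounded set\<close>

lemma finite_dyadic_meeting:
  assumes "bounded A"
  shows "finite (dyadic_meeting A j)"
proof -
  obtain B where B: "\<And>x. x \<in> A \<Longrightarrow> \<bar>x\<bar> \<le> B"
    using assms unfolding bounded_iff by auto
  have "dyadic_meeting A j \<subseteq> (\<lambda>k::int. {of_int k / 2 ^ j ..< (of_int k + 1) / 2 ^ j}) `
          {\<lfloor>- B * 2 ^ j - 1\<rfloor> .. \<lceil>B * 2 ^ j\<rceil>}"
  proof
    fix Q assume "Q \<in> dyadic_meeting A j"
    then obtain k :: int and x where k: "Q = {of_int k / 2 ^ j ..< (of_int k + 1) / 2 ^ j}"
      and x: "x \<in> A" "x \<in> Q"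
      unfolding dyadic_meeting_def dyadic_intervals_def by blast
    have "of_int k \<le> x * 2 ^ j" "x * 2 ^ j < of_int k + 1"
      using x(2) by (auto simp: k field_simps)
    moreover have "x * 2 ^ j \<le> B * 2 ^ j" "- B * 2 ^ j \<le> x * 2 ^ j"
      using B[OF x(1)] by (intro mult_right_mono; simp add: abs_le_iff)+
    ultimately have "- B * 2 ^ j - 1 \<le> of_int k" "of_int k \<le> B * 2 ^ j" by linarith+
    then have "k \<in> {\<lfloor>- B * 2 ^ j - 1\<rfloor> .. \<lceil>B * 2 ^ j\<rceil>}"
      unfolding atLeastAtMost_iff by linarith
    then show "Q \<in> (\<lambda>k::int. {of_int k / 2 ^ j ..< (of_int k + 1) / 2 ^ j}) `
          {\<lfloor>- B * 2 ^ j - 1\<rfloor> .. \<lceil>B * 2 ^ j\<rceil>}"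
      using k by blast
  qed
  then show ?thesis by (rule finite_subset) auto
qed

lemma card_dyadic_meeting_le_covering_number:
  assumes "bounded A"
  shows "card (dyadic_meeting A j) \<le> 2 * covering_number A (1 / 2 ^ j)"
proof -
  let ?D = "\<lambda>k::int. {of_int k / 2 ^ j ..< (of_int k + 1) / 2 ^ j :: real}"
  have "\<exists>n C. finite C \<and> card C = n \<and> A \<subseteq> (\<Union>c\<in>C. {c..c + 1 / 2 ^ j})"
  proof -
    \<comment> \<open>The left endpoints of the dyadic intervals form a finite cover, so the
      \<open>LEAST\<close> in \<open>covering_number\<close> is attained.\<close>
    let ?C = "Inf ` dyadic_meeting A j"
    have "A \<subseteq> (\<Union>c\<in>?C. {c..c + 1 / 2 ^ j})"
    proof
      fix x assume x: "x \<in> A"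
      obtain Q where Q: "Q \<in> dyadic_intervals j" "x \<in> Q"
        using dyadic_intervals_cover by blast
      then obtain k :: int where k: "Q = ?D k"
        unfolding dyadic_intervals_def by blast
      have "Inf Q = of_int k / 2 ^ j"
        unfolding k by (rule cInf_atLeastLessThan) (simp add: divide_strict_right_mono)
      then have "x \<in> {Inf Q..Inf Q + 1 / 2 ^ j}"
        using Q(2) by (auto simp: k add_divide_distrib)
      moreover have "Q \<in> dyadic_meeting A j"
        using Q x by (auto simp: dyadic_meeting_def)
      ultimately show "x \<in> (\<Union>c\<in>?C. {c..c + 1 / 2 ^ j})" by blast
    qed
    then show ?thesis
      using finite_dyadic_meeting[OF assms] by (intro exI[of _ "card ?C"] exI[of _ ?C]) simp
  qed
  then have "\<exists>C. finite C \<and> card C = covering_number A (1 / 2 ^ j) \<and> A \<subseteq> (\<Union>c\<in>C. {c..c + 1 / 2 ^ j})"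
    unfolding covering_number_def
    by (rule LeastI_ex[where P = "\<lambda>n. \<exists>C. finite C \<and> card C = n \<and> A \<subseteq> (\<Union>c\<in>C. {c..c + 1 / 2 ^ j})"])
  then obtain C where C: "finite C" "card C = covering_number A (1 / 2 ^ j)"
    "A \<subseteq> (\<Union>c\<in>C. {c..c + 1 / 2 ^ j})" by blast
  have "dyadic_meeting A j \<subseteq> (\<lambda>c. ?D \<lfloor>c * 2 ^ j\<rfloor>) ` C \<union> (\<lambda>c. ?D (\<lfloor>c * 2 ^ j\<rfloor> + 1)) ` C"
  proof
    fix Q assume "Q \<in> dyadic_meeting A j"
    then obtain k :: int and x where k: "Q = ?D k" and x: "x \<in> A" "x \<in> Q"
      unfolding dyadic_meeting_def dyadic_intervals_def by blast
    obtain c where c: "c \<in> C" "c \<le> x" "x \<le> c + 1 / 2 ^ j" using C(3) x(1) by auto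
    have "of_int k \<le> x * 2 ^ j" "x * 2 ^ j < of_int k + 1"
      using x(2) by (auto simp: k field_simps)
    moreover have "c * 2 ^ j \<le> x * 2 ^ j" "x * 2 ^ j \<le> c * 2 ^ j + 1"
      using c by (auto simp: field_simps)
    \<comment> \<open>A closed interval of length \<open>1 / 2 ^ j\<close> contains points of at
      most two dyadic intervals of that length, hence the factor 2.\<close>
    ultimately have "k = \<lfloor>c * 2 ^ j\<rfloor> \<or> k = \<lfloor>c * 2 ^ j\<rfloor> + 1" by linarith
    then show "Q \<in> (\<lambda>c. ?D \<lfloor>c * 2 ^ j\<rfloor>) ` C \<union> (\<lambda>c. ?D (\<lfloor>c * 2 ^ j\<rfloor> + 1)) ` C"
      using c(1) k by blast
  qed
  then have "card (dyadic_meeting A j)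
      \<le> card ((\<lambda>c. ?D \<lfloor>c * 2 ^ j\<rfloor>) ` C \<union> (\<lambda>c. ?D (\<lfloor>c * 2 ^ j\<rfloor> + 1)) ` C)"
    using C(1) by (intro card_mono) auto
  also have "\<dots> \<le> card ((\<lambda>c. ?D \<lfloor>c * 2 ^ j\<rfloor>) ` C) + card ((\<lambda>c. ?D (\<lfloor>c * 2 ^ j\<rfloor> + 1)) ` C)"
    by (rule card_Un_le)
  also have "\<dots> \<le> card C + card C"
    using C(1) by (intro add_mono card_image_le)
  finally show ?thesis using C(2) by simp
qed

lemma upper_box_dim_dyadic_bound:
  assumes "bounded A" "upper_box_dim A < ereal u"
  shows "\<forall>\<^sub>F j in sequentially. real (card (dyadic_meeting A j)) \<le> 2 * 2 powr (real j * u)"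
proof -
  have "\<forall>\<^sub>F r in at_right 0. ereal (ln (real (covering_number A r)) / - ln r) < ereal u"
    using assms(2) unfolding upper_box_dim_def by (rule Limsup_lessD)
  moreover have "filterlim (\<lambda>j. 1 / 2 ^ j :: real) (at_right 0) sequentially"
    using LIMSEQ_power_zero[of "1 / 2 :: real"]
    by (auto simp: filterlim_at power_one_over)
  ultimately have "\<forall>\<^sub>F j in sequentially.
      ereal (ln (real (covering_number A (1 / 2 ^ j))) / - ln (1 / 2 ^ j)) < ereal u"
    by (rule eventually_compose_filterlim)
  moreover have "\<forall>\<^sub>F j in sequentially. j > (0::nat)" by (rule eventually_gt_at_top)
  ultimately show ?thesis
  proof eventually_elim
    case (elim j)
    let ?N = "covering_number A (1 / 2 ^ j)"
    have "real ?N \<le> 2 powr (real j * u)"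
    \<comment> \<open>The logarithm says nothing about an empty cover, but then the bound is
      trivial.\<close>
    proof (cases "?N = 0")
      case False
      have "ln (real ?N) < u * (real j * ln 2)"
        using elim by (simp add: ln_div ln_realpow field_simps)
      then have "exp (ln (real ?N)) < exp (u * (real j * ln 2))"
        by (simp del: exp_ln)
      then show ?thesis using False by (simp add: powr_def mult_ac)
    qed simp
    then show ?case
      using card_dyadic_meeting_le_covering_number[OF assms(1), of j] by linarith
  qed
qed

subsection \<open>Pruning the dyadic tree\<close>

locale dyadic_pruning =
  fixes A :: "real set" and j :: "nat \<Rightarrow> nat" and t :: "nat \<Rightarrow> real"
  assumes compact_A: "compact A"
    and mono_j: "mono j"
    and threshold_gt_1: "1 < t l"
begin

definition children :: "nat \<Rightarrow> real set \<Rightarrow> real set set" where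
  "children l Q = {R \<in> dyadic_meeting A (j (Suc l)). R \<subseteq> Q}"

text \<open>The generation of an interval only grows along its descendants, so badness cannot be
  defined by recursion on \<open>l\<close>. The stage \<open>n\<close> counts rounds of discarding
  instead, which makes the least fixed point a union of finite approximations.\<close>

primrec bad :: "nat \<Rightarrow> nat \<Rightarrow> real set \<Rightarrow> bool" where
  "bad 0 l Q = False"
| "bad (Suc n) l Q = (real (card {R \<in> children l Q. \<not> bad n (Suc l) R}) < t l)"

definition good :: "nat \<Rightarrow> real set \<Rightarrow> bool" where
  "good l Q \<longleftrightarrow> Q \<in> dyadic_meeting A (j l) \<and> (\<forall>n. \<not> bad n l Q)"

text \<open>Exactly one dyadic interval per level contains \<open>x\<close>, and the inner
  quantifier speaks of it. Levels below \<open>l0\<close> are free, so that pruning can start where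
  little content is lost.\<close>

definition kernel :: "nat \<Rightarrow> real set" where
  "kernel l0 = {x \<in> A. \<forall>l\<ge>l0. \<forall>Q\<in>dyadic_intervals (j l). x \<in> Q \<longrightarrow> good l Q}"

text \<open>For a bad \<open>Q\<close>, these are the children that survive just before the first
  stage at which \<open>Q\<close> is bad. They are the ones counted when \<open>Q\<close> is
  discarded.\<close>

definition lost :: "nat \<Rightarrow> real set \<Rightarrow> real set set" where
  "lost l Q = {R \<in> children l Q. \<not> bad ((LEAST n. bad n l Q) - 1) (Suc l) R}"

lemma finite_meeting: "finite (dyadic_meeting A i)"
  using finite_dyadic_meeting compact_imp_bounded[OF compact_A] by blast

lemma finite_children: "finite (children l Q)"
  unfolding children_def using finite_meeting by auto

lemma child_at_point:
  assumes "Q \<in> dyadic_intervals (j l)" "x \<in> Q" "x \<in> A"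
  obtains R where "R \<in> children l Q" "x \<in> R"
proof -
  obtain R where R: "R \<in> dyadic_intervals (j (Suc l))" "x \<in> R"
    using dyadic_intervals_cover by blast
  have "R \<subseteq> Q"
    using dyadic_intervals_subset[OF assms(1) R(1)] mono_j assms(2) R(2)
    by (auto simp: mono_def)
  with R assms that show thesis by (auto simp: children_def dyadic_meeting_def)
qed

lemma bad_Suc: "bad n l Q \<Longrightarrow> bad (Suc n) l Q"
proof (induction n arbitrary: l Q)
  case (Suc n)
  have "card {R \<in> children l Q. \<not> bad (Suc n) (Suc l) R} \<le> card {R \<in> children l Q. \<not> bad n (Suc l) R}"
    using Suc.IH finite_children[of l Q] by (intro card_mono) (auto simp del: bad.simps)
  then show ?case using Suc.prems by (simp del: bad.simps(2) add: bad.simps(2)[of _ l Q])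
qed simp

lemma bad_mono: "m \<le> n \<Longrightarrow> bad m l Q \<Longrightarrow> bad n l Q"
  by (induction rule: dec_induct) (auto simp del: bad.simps intro: bad_Suc)

lemma card_good_children:
  assumes "good l Q"
  shows "t l \<le> real (card {R \<in> children l Q. good (Suc l) R})"
proof -
  define r where "r R = (SOME n. bad n (Suc l) R)" for R
  have r: "bad n (Suc l) R \<Longrightarrow> bad (r R) (Suc l) R" for n R
    unfolding r_def by (rule someI)
  \<comment> \<open>There are finitely many children, and the sum dominates each of their stages. At
    stage \<open>N\<close> all children that ever turn bad have done so.\<close>
  define N where "N = sum r (children l Q)"
  have "bad N (Suc l) R" if "R \<in> children l Q" "bad n (Suc l) R" for R n
    unfolding N_def using that finite_children
    by (intro bad_mono[OF member_le_sum[of R "children l Q" r] r]) auto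
  then have "{R \<in> children l Q. \<not> bad N (Suc l) R} = {R \<in> children l Q. good (Suc l) R}"
    by (auto simp: good_def children_def)
  moreover have "\<not> bad (Suc N) l Q" using assms by (simp add: good_def del: bad.simps)
  ultimately show ?thesis by simp
qed

text \<open>Nested half-open intervals can have empty intersection. This cannot happen when each
  interval contains the closure of the next, and two good children leave such a choice.\<close>

lemma good_child_closure:
  assumes "good l Q"
  shows "\<exists>R. good (Suc l) R \<and> closure R \<subseteq> Q"
proof -
  let ?G = "{R \<in> children l Q. good (Suc l) R}"
  have "\<not> card ?G \<le> Suc 0"
    using card_good_children[OF assms] threshold_gt_1[of l] by linarith
  then obtain R R' where R: "R \<in> ?G" "R' \<in> ?G" "R \<noteq> R'"
    using card_le_Suc0_iff_eq[of ?G] finite_children[of l Q] by auto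
  then have "closure R \<subseteq> Q \<or> closure R' \<subseteq> Q"
    using dyadic_closure_subset[of Q "j l" R "j (Suc l)" R'] assms
    by (auto simp: good_def children_def dyadic_meeting_def)
  with R show ?thesis by blast
qed

text \<open>Good intervals are chosen one inside another, each containing the closure of the next.
  Compactness of \<open>A\<close> gives a common point, and disjointness within a level identifies
  every dyadic interval through that point with one of the chosen ones.\<close>

lemma good_contains_point:
  assumes "good l Q"
  obtains x where "x \<in> A" "x \<in> Q"
    "\<And>m R. l \<le> m \<Longrightarrow> R \<in> dyadic_intervals (j m) \<Longrightarrow> x \<in> R \<Longrightarrow> good m R"
proof -
  have "\<exists>f. \<forall>n. (good (l + n) (f n) \<and> (n = 0 \<longrightarrow> f n = Q)) \<and> closure (f (Suc n)) \<subseteq> f n"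
  proof (rule dependent_nat_choice)
    show "\<exists>R. good (l + 0) R \<and> (0 = 0 \<longrightarrow> R = Q)" using assms by auto
    show "\<exists>S. (good (l + Suc n) S \<and> (Suc n = 0 \<longrightarrow> S = Q)) \<and> closure S \<subseteq> R"
      if "good (l + n) R \<and> (n = 0 \<longrightarrow> R = Q)" for R n
      using good_child_closure[of "l + n" R] that by auto
  qed
  then obtain f where f: "f 0 = Q" "\<And>n. good (l + n) (f n)" "\<And>n. closure (f (Suc n)) \<subseteq> f n"
    by metis
  have dec: "f (Suc n) \<subseteq> f n" for n
    using f(3) closure_subset by blast
  have "(\<Inter>n. A \<inter> closure (f n)) \<noteq> {}"
  proof (rule compact_nest)
    show "compact (A \<inter> closure (f n))" for n
      using compact_A by (intro compact_Int_closed) auto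
    show "A \<inter> closure (f n) \<noteq> {}" for n
      using f(2)[of n] closure_subset[of "f n"] by (auto simp: good_def dyadic_meeting_def)
    show "A \<inter> closure (f n) \<subseteq> A \<inter> closure (f m)" if "m \<le> n" for m n
      using lift_Suc_antimono_le[of f, OF dec that] closure_mono by blast
  qed
  then obtain x where x: "\<And>n. x \<in> A \<inter> closure (f n)" by blast
  \<comment> \<open>Membership in the closure of the next interval removes the closure here.\<close>
  then have xf: "x \<in> f n" for n using f(3)[of n] x[of "Suc n"] by blast
  show thesis
  proof (rule that)
    show "x \<in> A" "x \<in> Q" using x xf[of 0] f(1) by auto
    fix m R assume R: "l \<le> m" "R \<in> dyadic_intervals (j m)" "x \<in> R"
    then have "f (m - l) \<in> dyadic_intervals (j m)"
      using f(2)[of "m - l"] by (auto simp: good_def dyadic_meeting_def)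
    then have "R = f (m - l)" using dyadic_intervals_eq[OF R(2)] R(3) xf by blast
    then show "good m R" using f(2)[of "m - l"] R(1) by simp
  qed
qed

section \<open>The kernel and a cover of its complement in the set\<close>

lemma kernel_subset: "kernel l0 \<subseteq> A"
  by (auto simp: kernel_def)

text \<open>A good child contains a point all of whose deeper intervals are good. That point also
  belongs to the kernel, because its ancestors from level \<open>l0\<close> to \<open>l\<close> are
  shared with a kernel point of \<open>Q\<close>.\<close>

lemma card_kernel_children:
  assumes "l0 \<le> l" "Q \<in> dyadic_intervals (j l)" "Q \<inter> kernel l0 \<noteq> {}"
  shows "t l \<le> real (card {R \<in> dyadic_meeting A (j (Suc l)). R \<subseteq> Q \<and> R \<inter> kernel l0 \<noteq> {}})"
proof -
  obtain y where y: "y \<in> Q" "y \<in> kernel l0" using assms(3) by blast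
  then have "good l Q" using assms by (auto simp: kernel_def)
  moreover have "R \<inter> kernel l0 \<noteq> {}" if R: "R \<in> children l Q" "good (Suc l) R" for R
  proof -
    obtain x where x: "x \<in> A" "x \<in> R"
      and xg: "\<And>m S. Suc l \<le> m \<Longrightarrow> S \<in> dyadic_intervals (j m) \<Longrightarrow> x \<in> S \<Longrightarrow> good m S"
      using good_contains_point[OF R(2)] by metis
    have "good m S" if S: "l0 \<le> m" "S \<in> dyadic_intervals (j m)" "x \<in> S" for m S
    proof (cases "Suc l \<le> m")
      case False
      then have "Q \<subseteq> S"
        using dyadic_intervals_subset[OF S(2) assms(2)] monoD[OF mono_j, of m l] S(3) x(2) R(1)
        by (auto simp: children_def)
      then show ?thesis using y S by (auto simp: kernel_def)
    qed (use xg S in blast)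
    then have "x \<in> kernel l0" using x(1) by (auto simp: kernel_def)
    then show ?thesis using x(2) by blast
  qed
  ultimately have "t l \<le> real (card {R \<in> children l Q. good (Suc l) R})"
    "{R \<in> children l Q. good (Suc l) R}
      \<subseteq> {R \<in> dyadic_meeting A (j (Suc l)). R \<subseteq> Q \<and> R \<inter> kernel l0 \<noteq> {}}"
    using card_good_children by (auto simp: children_def)
  moreover from this(2) have "card {R \<in> children l Q. good (Suc l) R}
      \<le> card {R \<in> dyadic_meeting A (j (Suc l)). R \<subseteq> Q \<and> R \<inter> kernel l0 \<noteq> {}}"
    using finite_meeting by (intro card_mono) auto
  ultimately show ?thesis by linarith
qed

text \<open>No interval is bad at stage 0, so the first bad stage is a successor. The defining
  inequality of \<open>bad\<close> at that stage is the claim.\<close>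

lemma card_lost:
  assumes "bad n l Q"
  shows "real (card (lost l Q)) < t l"
proof -
  have "bad (LEAST n. bad n l Q) l Q" by (rule LeastI) (rule assms)
  then show ?thesis unfolding lost_def by (cases "LEAST n. bad n l Q") auto
qed

text \<open>As long as the child through \<open>x\<close> is not lost, the stage at which the interval through
  \<open>x\<close> turns bad decreases.\<close>

lemma bad_point_lost:
  assumes "bad n l Q" "Q \<in> dyadic_intervals (j l)" "x \<in> Q" "x \<in> A"
  shows "\<exists>m\<ge>l. \<exists>P\<in>dyadic_meeting A (j m). (\<exists>n. bad n m P) \<and> x \<in> \<Union>(lost m P)"
  using assms(1-3)
proof (induction n arbitrary: l Q)
  case (Suc n)
  define r where "r = (LEAST n. bad n l Q)"
  have "r \<le> Suc n" unfolding r_def by (rule Least_le) (rule Suc.prems(1))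
  obtain R where R: "R \<in> children l Q" "x \<in> R"
    using child_at_point[OF Suc.prems(2,3) assms(4)] .
  show ?case
  proof (cases "bad (r - 1) (Suc l) R")
    case True
    then have "bad n (Suc l) R" using \<open>r \<le> Suc n\<close> by (intro bad_mono[of "r - 1" n]) auto
    moreover have "R \<in> dyadic_intervals (j (Suc l))"
      using R(1) by (simp add: children_def dyadic_meeting_def)
    ultimately show ?thesis using Suc.IH R(2) Suc_leD by blast
  next
    case False
    then have "x \<in> \<Union>(lost l Q)" using R by (auto simp: lost_def r_def)
    moreover have "Q \<in> dyadic_meeting A (j l)"
      using Suc.prems assms(4) by (auto simp: dyadic_meeting_def)
    ultimately show ?thesis using Suc.prems(1) by blast
  qed
qed simp

text \<open>\<open>C m\<close> collects the lost children of all bad intervals at level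
  \<open>m\<close>. It does not depend on \<open>l0\<close>, so content can be estimated level by
  level before the starting level is chosen.\<close>

lemma outside_kernel_cover:
  obtains C where "\<And>m. C m \<subseteq> dyadic_intervals (j (Suc m))" "\<And>m. finite (C m)"
    "\<And>m. real (card (C m)) \<le> real (card (dyadic_meeting A (j m))) * t m"
    "\<And>l0. A \<subseteq> kernel l0 \<union> (\<Union>m\<in>{l0..}. \<Union>(C m))"
proof
  let ?B = "\<lambda>m. {P \<in> dyadic_meeting A (j m). \<exists>n. bad n m P}"
  let ?C = "\<lambda>m. \<Union>P\<in>?B m. lost m P"
  show "?C m \<subseteq> dyadic_intervals (j (Suc m))" for m
    by (auto simp: lost_def children_def dyadic_meeting_def)
  show "finite (?C m)" for m
    using finite_meeting finite_children by (auto simp: lost_def)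
  show "real (card (?C m)) \<le> real (card (dyadic_meeting A (j m))) * t m" for m
  proof -
    have fin: "finite (?B m)" using finite_meeting by simp
    have "real (card (?C m)) \<le> real (\<Sum>P\<in>?B m. card (lost m P))"
      using card_UN_le[OF fin, of "lost m"] by linarith
    also have "\<dots> \<le> (\<Sum>P\<in>?B m. t m)"
      unfolding of_nat_sum using card_lost by (intro sum_mono) (auto intro: less_imp_le)
    also have "\<dots> \<le> real (card (dyadic_meeting A (j m))) * t m"
      using threshold_gt_1[of m] card_mono[OF finite_meeting, of "?B m" "j m"]
      by (auto intro!: mult_right_mono)
    finally show ?thesis .
  qed
  show "A \<subseteq> kernel l0 \<union> (\<Union>m\<in>{l0..}. \<Union>(?C m))" for l0
  proof
    fix x assume x: "x \<in> A"
    show "x \<in> kernel l0 \<union> (\<Union>m\<in>{l0..}. \<Union>(?C m))"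
    proof (cases "x \<in> kernel l0")
      case False
      \<comment> \<open>An interval through \<open>x\<close> meets \<open>A\<close>, so if it is not
        good it is bad at some stage.\<close>
      then obtain l Q n where "l0 \<le> l" "Q \<in> dyadic_intervals (j l)" "x \<in> Q" "bad n l Q"
        using x unfolding kernel_def good_def by (auto simp: dyadic_meeting_def)
      then show ?thesis using bad_point_lost[of n l Q x] x by fastforce
    qed simp
  qed
qed

end

text \<open>Children of different intervals of one level are different, so branching numbers
  multiply over generations. Writing the exponents as increments of \<open>e\<close> makes the
  product telescope.\<close>

lemma card_descendants_ge:
  fixes K A :: "real set" and j :: "nat \<Rightarrow> nat" and e :: "nat \<Rightarrow> real"
  assumes "bounded A"
    and step: "\<And>l Q. l0 \<le> l \<Longrightarrow> Q \<in> dyadic_intervals (j l) \<Longrightarrow> Q \<inter> K \<noteq> {} \<Longrightarrow>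
      2 powr (e (Suc l) - e l) \<le> real (card {R \<in> dyadic_meeting A (j (Suc l)). R \<subseteq> Q \<and> R \<inter> K \<noteq> {}})"
    and "l0 \<le> l" "Q \<in> dyadic_meeting A (j l)" "Q \<inter> K \<noteq> {}"
  shows "2 powr (e (l + n) - e l)
    \<le> real (card {R \<in> dyadic_meeting A (j (l + n)). R \<subseteq> Q \<and> R \<inter> K \<noteq> {}})"
proof (induction n)
  case 0
  have "{Q} \<subseteq> {R \<in> dyadic_meeting A (j (l + 0)). R \<subseteq> Q \<and> R \<inter> K \<noteq> {}}"
    using assms(4,5) by auto
  then have "card {Q} \<le> card {R \<in> dyadic_meeting A (j (l + 0)). R \<subseteq> Q \<and> R \<inter> K \<noteq> {}}"
    using finite_dyadic_meeting[OF assms(1)] by (intro card_mono) auto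
  then show ?case by simp
next
  case (Suc n)
  let ?D = "\<lambda>m Q. {R \<in> dyadic_meeting A (j m). R \<subseteq> Q \<and> R \<inter> K \<noteq> {}}"
  have fin: "finite (?D m P)" for m P
    using finite_dyadic_meeting[OF assms(1)] by simp
  have "2 powr (e (l + Suc n) - e l) = 2 powr (e (l + n) - e l) * 2 powr (e (Suc (l + n)) - e (l + n))"
    by (simp flip: powr_add)
  also have "\<dots> \<le> real (card (?D (l + n) Q)) * 2 powr (e (Suc (l + n)) - e (l + n))"
    by (intro mult_right_mono Suc.IH) simp
  also have "\<dots> = (\<Sum>P\<in>?D (l + n) Q. 2 powr (e (Suc (l + n)) - e (l + n)))"
    by simp
  also have "\<dots> \<le> (\<Sum>P\<in>?D (l + n) Q. real (card (?D (Suc (l + n)) P)))"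
    using assms(3) by (intro sum_mono step) (auto simp: dyadic_meeting_def)
  also have "\<dots> = real (card (\<Union>P\<in>?D (l + n) Q. ?D (Suc (l + n)) P))"
  proof -
    have "?D (Suc (l + n)) P \<inter> ?D (Suc (l + n)) P' = {}"
      if "P \<in> ?D (l + n) Q" "P' \<in> ?D (l + n) Q" "P \<noteq> P'" for P P'
    \<comment> \<open>A common child would meet \<open>K\<close>, hence be nonempty, and lie in both
      parents, which are disjoint.\<close>
    proof -
      have "P \<inter> P' = {}"
        using dyadic_intervals_eq[of P "j (l + n)" P'] that by (auto simp: dyadic_meeting_def)
      then show ?thesis by blast
    qed
    then have "card (\<Union>P\<in>?D (l + n) Q. ?D (Suc (l + n)) P) = (\<Sum>P\<in>?D (l + n) Q. card (?D (Suc (l + n)) P))"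
      by (intro card_UN_disjoint ballI fin impI)
    then show ?thesis by simp
  qed
  also have "\<dots> \<le> real (card (?D (l + Suc n) Q))"
    by (intro of_nat_mono card_mono fin) auto
  finally show ?case .
qed

subsection \<open>Content estimates at geometric scales\<close>

lemma geom_scale_bounds:
  assumes "0 < b"
  shows "real (geom_scale b 1 l) \<le> (1 + b) ^ l" "(1 + b) ^ l < real (geom_scale b 1 l) + 1"
proof -
  have "0 \<le> (1 + b) ^ l" using assms by simp
  then show "real (geom_scale b 1 l) \<le> (1 + b) ^ l" "(1 + b) ^ l < real (geom_scale b 1 l) + 1"
    unfolding geom_scale_def by (simp_all add: of_nat_nat)
qed

lemma mono_geom_scale: "0 < b \<Longrightarrow> mono (geom_scale b J)"
  unfolding geom_scale_def
  by (intro monoI nat_mono floor_mono mult_right_mono power_increasing) auto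

text \<open>Bernoulli's inequality gives \<open>(1 + b) ^ l \<ge> 1 + b * l\<close>, and the floor
  costs less than 1.\<close>

lemma filterlim_geom_scale:
  assumes "0 < b"
  shows "filterlim (geom_scale b 1) at_top sequentially"
proof -
  have "filterlim (\<lambda>l. b * real l) at_top sequentially"
    by (rule filterlim_tendsto_pos_mult_at_top[OF tendsto_const assms filterlim_real_sequentially])
  moreover have "b * real l \<le> real (geom_scale b 1 l)" for l
    using Bernoulli_inequality[of b l] geom_scale_bounds(2)[OF assms, of l] assms
    by (simp add: mult.commute)
  ultimately have "filterlim (\<lambda>l. real (geom_scale b 1 l)) at_top sequentially"
    by (rule filterlim_at_top_mono[OF _ always_eventually[OF allI]])
  then show ?thesis by (simp add: filterlim_sequentially_iff_filterlim_real)
qed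

text \<open>Half of \<open>e\<close> is spent on the strict box-dimension bound, the other half
  absorbs the factor 2 once \<open>j \<ge> 2 / e\<close>.\<close>

lemma eventually_card_dyadic_meeting_le:
  assumes "bounded A" "upper_box_dim A = ereal d" "0 < e"
  shows "\<forall>\<^sub>F j in sequentially. real (card (dyadic_meeting A j)) \<le> 2 powr (real j * (d + e))"
proof -
  have "\<forall>\<^sub>F j in sequentially. real (card (dyadic_meeting A j)) \<le> 2 * 2 powr (real j * (d + e / 2))"
    using assms by (intro upper_box_dim_dyadic_bound) auto
  moreover have "\<forall>\<^sub>F j in sequentially. real j \<ge> 2 / e"
    using filterlim_real_sequentially by (simp add: filterlim_at_top)
  ultimately show ?thesis
  proof eventually_elim
    case (elim j)
    have "2 * 2 powr (real j * (d + e / 2)) = 2 powr (1 + real j * (d + e / 2))"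
      by (simp add: powr_add)
    also have "\<dots> \<le> 2 powr (real j * (d + e))"
      using elim(2) assms(3) by (intro powr_mono) (auto simp: field_simps)
    finally show ?case using elim(1) by linarith
  qed
qed

lemma eventually_dyadic_le:
  assumes "0 < \<delta>"
  shows "\<forall>\<^sub>F j in sequentially. 1 / 2 ^ j \<le> (\<delta> :: real)"
proof -
  have "\<forall>\<^sub>F j in sequentially. (1 / 2) ^ j < \<delta>"
    using LIMSEQ_power_zero[of "1 / 2 :: real"] assms by (intro order_tendstoD) auto
  then show ?thesis by eventually_elim (simp add: power_one_over)
qed

lemma powr_inverse_power_2: "(1 / 2 ^ j) powr s = 2 powr (- (real j * s))"
proof -
  have "1 / 2 ^ j = (2 :: real) powr (- real j)"
    by (simp add: powr_minus powr_realpow divide_inverse)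
  then show ?thesis by (simp add: powr_powr)
qed

text \<open>The content lost from level \<open>l0\<close> on is bounded by the tail of a geometric
  series, which for large \<open>l0\<close> is smaller than the content of \<open>A\<close>.
  Positive content at one scale is recorded rather than a dimension bound, as it also yields the
  lower count of intervals.\<close>

lemma pruned_kernel_exists:
  fixes A :: "real set"
  assumes "compact A" and d: "d = hausdorff_dim A" "upper_box_dim A = ereal d"
    and b: "0 < b" "b < 1" and e: "0 < e" "5 * e < b * d"
  shows "\<exists>K \<delta> l0. K \<subseteq> A \<and> 0 < \<delta> \<and> \<delta> \<le> 1 \<and> 0 < hausdorff_content (d - e) \<delta> K \<and>
    (\<forall>l\<ge>l0. \<forall>Q\<in>dyadic_intervals (geom_scale b 1 l). Q \<inter> K \<noteq> {} \<longrightarrow>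
      2 powr ((1 + b) ^ Suc l * (d - 5 * e / b) - (1 + b) ^ l * (d - 5 * e / b))
        \<le> real (card {R \<in> dyadic_meeting A (geom_scale b 1 (Suc l)). R \<subseteq> Q \<and> R \<inter> K \<noteq> {}}))"
proof -
  let ?j = "geom_scale b 1"
  define t where "t l = 2 powr ((1 + b) ^ l * (b * d - 5 * e))" for l :: nat
  \<comment> \<open>\<open>M\<close> pays for the floor in the scale of level \<open>l + 1\<close>,
    which is off by less than 1; \<open>q\<close> is the ratio of the losses.\<close>
  define M where "M = 2 powr (d - e)"
  define q where "q = 2 powr (- 2 * e * b)"
  have q: "0 < q" "q < 1" using e b by (auto simp: q_def powr_less_one)
  have "0 < b * d" using e by linarith
  then have d0: "0 < d" using b by (simp add: zero_less_mult_iff)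
  then have "b * d < d" using b by simp
  then have ed: "0 < d - e" using e by linarith
  have bd: "bounded A" using \<open>compact A\<close> by (rule compact_imp_bounded)
  interpret dyadic_pruning A ?j t
  proof
    show "1 < t l" for l using e b by (simp add: t_def)
  qed (use \<open>compact A\<close> mono_geom_scale b in auto)
  obtain \<delta> where \<delta>: "0 < \<delta>" "\<delta> \<le> 1" "0 < hausdorff_content (d - e) \<delta> A"
    using hausdorff_content_pos_of_less_dim[of "d - e" A] ed e d by auto
  obtain C where C: "\<And>m. C m \<subseteq> dyadic_intervals (?j (Suc m))" "\<And>m. finite (C m)"
    "\<And>m. real (card (C m)) \<le> real (card (dyadic_meeting A (?j m))) * t m"
    "\<And>l0. A \<subseteq> kernel l0 \<union> (\<Union>m\<in>{l0..}. \<Union>(C m))"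
    using outside_kernel_cover by metis
  have "\<forall>\<^sub>F l in sequentially. real (card (dyadic_meeting A (?j l))) \<le> 2 powr (real (?j l) * (d + e))"
    using eventually_card_dyadic_meeting_le[OF bd d(2) e(1)] filterlim_geom_scale[OF b(1)]
    by (rule eventually_compose_filterlim)
  moreover have "\<forall>\<^sub>F l in sequentially. 1 / 2 ^ ?j (Suc l) \<le> \<delta>"
    using eventually_dyadic_le[OF \<delta>(1)] filterlim_compose[OF filterlim_geom_scale[OF b(1)] filterlim_Suc]
    by (rule eventually_compose_filterlim)
  ultimately have "\<forall>\<^sub>F l in sequentially. hausdorff_content (d - e) \<delta> (\<Union>(C l)) \<le> ennreal (M * q ^ l)"
  proof eventually_elim
    case (elim l)
    let ?T = "(1 + b) ^ l"
    have T: "real l * b \<le> ?T"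
      using Bernoulli_inequality[of b l] b by simp
    have "hausdorff_content (d - e) \<delta> (\<Union>(C l))
        \<le> ennreal (real (card (C l)) * (1 / 2 ^ ?j (Suc l)) powr (d - e))"
      using C(1)[of l] elim \<delta>(1)
      by (intro hausdorff_content_Union_le C(2))
        (auto simp: diameter_dyadic_intervals bounded_dyadic_intervals subset_iff)
    also have "real (card (C l)) * (1 / 2 ^ ?j (Suc l)) powr (d - e)
        \<le> (2 powr (real (?j l) * (d + e)) * t l) * 2 powr (- (real (?j (Suc l)) * (d - e)))"
      unfolding powr_inverse_power_2
      using threshold_gt_1[of l]
      by (intro mult_right_mono order_trans[OF C(3)] mult_right_mono[OF elim(1)]) auto
    also have "\<dots> = 2 powr (real (?j l) * (d + e) + ?T * (b * d - 5 * e) - real (?j (Suc l)) * (d - e))"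
      by (simp add: t_def powr_add powr_diff powr_minus divide_inverse)
    also have "\<dots> \<le> 2 powr ((d - e) + real l * (- 2 * e * b))"
    \<comment> \<open>With the floors replaced by their bounds, the left exponent becomes
      \<open>(d - e) + ?T * (b * e - 3 * e)\<close>. Now \<open>b < 1\<close> and
      \<open>?T \<ge> l * b\<close> give the claim.\<close>
    proof (intro powr_mono)
      have "real (?j l) * (d + e) \<le> ?T * (d + e)"
        using geom_scale_bounds(1)[OF b(1)] d0 e by (intro mult_right_mono) auto
      moreover have "((1 + b) * ?T - 1) * (d - e) \<le> real (?j (Suc l)) * (d - e)"
        using geom_scale_bounds(2)[OF b(1), of "Suc l"] ed by (intro mult_right_mono) auto
      moreover have "e * (real l * b) \<le> e * ?T" "b * (e * ?T) \<le> 1 * (e * ?T)"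
        using T e b by (intro mult_left_mono mult_right_mono; simp)+
      ultimately show "real (?j l) * (d + e) + ?T * (b * d - 5 * e) - real (?j (Suc l)) * (d - e)
          \<le> (d - e) + real l * (- 2 * e * b)"
        by (simp add: algebra_simps)
    qed simp
    also have "\<dots> = M * q ^ l"
      unfolding M_def q_def powr_add by (simp add: powr_power mult_ac)
    finally show ?case by (simp add: ennreal_leI)
  qed
  then obtain L where L: "\<And>l. L \<le> l \<Longrightarrow> hausdorff_content (d - e) \<delta> (\<Union>(C l)) \<le> ennreal (M * q ^ l)"
    by (auto simp: eventually_sequentially)
  have "(\<lambda>l. ennreal (M * q ^ l / (1 - q))) \<longlonglongrightarrow> ennreal (M * 0 / (1 - q))"
    using q by (intro tendsto_intros LIMSEQ_power_zero) auto
  then have "\<forall>\<^sub>F l in sequentially. L \<le> l \<and> ennreal (M * q ^ l / (1 - q)) < hausdorff_content (d - e) \<delta> A"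
    using \<delta>(3) by (intro eventually_conj eventually_ge_at_top order_tendstoD) auto
  then obtain l0 where l0: "L \<le> l0" "ennreal (M * q ^ l0 / (1 - q)) < hausdorff_content (d - e) \<delta> A"
    using eventually_happens'[OF sequentially_bot] by blast
  have "0 < hausdorff_content (d - e) \<delta> (kernel l0)"
  \<comment> \<open>If the kernel had content 0, the lost intervals alone would carry the content of
    \<open>A\<close>, contradicting the choice of \<open>l0\<close>.\<close>
  proof (rule ccontr)
    assume "\<not> 0 < hausdorff_content (d - e) \<delta> (kernel l0)"
    then have 0: "hausdorff_content (d - e) \<delta> (kernel l0) = 0" by simp
    have "A \<subseteq> kernel l0 \<union> (\<Union>i. \<Union>(C (l0 + i)))"
    proof
      fix x assume "x \<in> A"
      then consider "x \<in> kernel l0" | m where "l0 \<le> m" "x \<in> \<Union>(C m)"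
        using C(4)[of l0] by blast
      then show "x \<in> kernel l0 \<union> (\<Union>i. \<Union>(C (l0 + i)))"
        by cases (auto dest!: le_Suc_ex)
    qed
    then have "hausdorff_content (d - e) \<delta> A
        \<le> hausdorff_content (d - e) \<delta> (kernel l0 \<union> (\<Union>i. \<Union>(C (l0 + i))))"
      by (rule hausdorff_content_mono)
    also have "\<dots> \<le> hausdorff_content (d - e) \<delta> (\<Union>i. \<Union>(C (l0 + i)))"
      using hausdorff_content_Un_le[of \<delta> "d - e" "kernel l0"] \<delta>(1) 0 by simp
    also have "\<dots> \<le> (\<Sum>i. hausdorff_content (d - e) \<delta> (\<Union>(C (l0 + i))))"
      by (rule hausdorff_content_UN_le)
    also have "\<dots> \<le> (\<Sum>i. ennreal (M * q ^ (l0 + i)))"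
      using L l0(1) by (intro suminf_le) auto
    also have "\<dots> = ennreal (M * q ^ l0 / (1 - q))"
    proof -
      have "(\<lambda>i. M * q ^ l0 * q ^ i) sums (M * q ^ l0 * (1 / (1 - q)))"
        using q by (intro sums_mult geometric_sums) auto
      then show ?thesis
        using q by (intro suminf_ennreal_eq) (auto simp: M_def power_add mult_ac)
    qed
    finally show False using l0(2) by simp
  qed
  \<comment> \<open>The threshold is a one-step increment of
    \<open>(1 + b) ^ l * (d - 5 * e / b)\<close>, the form needed for telescoping.\<close>
  moreover have "2 powr ((1 + b) ^ Suc l * (d - 5 * e / b) - (1 + b) ^ l * (d - 5 * e / b)) = t l" for l
  proof -
    have *: "b * d - 5 * e = b * (d - 5 * e / b)" using b by (simp add: field_simps)
    show ?thesis unfolding t_def * by (simp add: algebra_simps)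
  qed
  moreover have "kernel l0 \<subseteq> A" by (rule kernel_subset)
  ultimately show ?thesis
    using \<delta>(1,2) card_kernel_children[of l0]
    by (intro exI[of _ "kernel l0"] exI[of _ \<delta>] exI[of _ l0] conjI allI ballI impI) (simp_all only:)
qed

section \<open>Dimension, interval counts and branching of the pruned set\<close>

theorem theorem1p2:
  fixes I :: "real set" and \<epsilon> b :: real
  assumes "compact I" and "I \<subseteq> {0..1}"
    and "ereal (hausdorff_dim I) = upper_box_dim I"
    and "hausdorff_dim I > 0"
    and "\<epsilon> > 0" and "b \<in> {0<..<1}"
  shows "\<exists>(K :: real set) (J :: nat) (l0 :: nat). K \<subseteq> I \<and> J \<ge> 1 \<and>
    (hausdorff_dim I - \<epsilon> \<le> hausdorff_dim K \<and> hausdorff_dim K \<le> hausdorff_dim I) \<and>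
    (\<forall>l\<ge>l0. let j = geom_scale b J l; N = card {Q \<in> dyadic_meeting I j. Q \<inter> K \<noteq> {}} in
        2 powr (real j * (hausdorff_dim I - \<epsilon>)) \<le> real N \<and>
        real N \<le> 2 powr (real j * (hausdorff_dim I + \<epsilon>))) \<and>
    (\<forall>l\<ge>l0. \<forall>Q \<in> dyadic_meeting I (geom_scale b J l). Q \<inter> K \<noteq> {} \<longrightarrow>
      (\<forall>l'\<ge>1.
        real (card {Q' \<in> dyadic_meeting I (geom_scale b J (l + l')). Q' \<subseteq> Q \<and> Q' \<inter> K \<noteq> {}})
          \<ge> 2 powr (((1 + b) ^ l' - 1) * ((1 + b) ^ l * real J) * (hausdorff_dim I - 5 * \<epsilon> / b))))"
proof -
  let ?j = "geom_scale b 1"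
  define d where "d = hausdorff_dim I"
  \<comment> \<open>The bound \<open>\<epsilon> / 2\<close> leaves room for a second loss of
    \<open>e\<close> in the lower count; \<open>b * d / 6\<close> ensures
    \<open>5 * e < b * d\<close>, however large \<epsilon> is.\<close>
  define e where "e = min (\<epsilon> / 2) (b * d / 6)"
  have b: "0 < b" "b < 1" using assms(6) by auto
  have d: "0 < d" using assms(4) by (simp add: d_def)
  have e: "0 < e" "5 * e < b * d" "2 * e \<le> \<epsilon>"
    using assms(5) b d mult_pos_pos[of b d] by (auto simp: e_def min_def)
  have bd: "bounded I" using assms(1) by (rule compact_imp_bounded)
  obtain K \<delta> l0 where K: "K \<subseteq> I" "0 < \<delta>" "\<delta> \<le> 1" "0 < hausdorff_content (d - e) \<delta> K"
    and step: "\<forall>l\<ge>l0. \<forall>Q\<in>dyadic_intervals (?j l). Q \<inter> K \<noteq> {} \<longrightarrow>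
      2 powr ((1 + b) ^ Suc l * (d - 5 * e / b) - (1 + b) ^ l * (d - 5 * e / b))
        \<le> real (card {R \<in> dyadic_meeting I (?j (Suc l)). R \<subseteq> Q \<and> R \<inter> K \<noteq> {}})"
    using pruned_kernel_exists[OF assms(1) d_def assms(3)[symmetric, folded d_def] b e(1,2)] by auto
  let ?S = "\<lambda>j. {Q \<in> dyadic_meeting I j. Q \<inter> K \<noteq> {}}"
  obtain c where c: "0 < c" "ennreal c \<le> hausdorff_content (d - e) \<delta> K"
  proof
    \<comment> \<open>Truncation at 1 makes the bound a real number without a finiteness
      argument.\<close>
    let ?c = "min 1 (hausdorff_content (d - e) \<delta> K)"
    have "?c < top" by (simp add: min_less_iff_disj)
    then show "0 < enn2real ?c" "ennreal (enn2real ?c) \<le> hausdorff_content (d - e) \<delta> K"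
      using K(4) by (simp_all add: enn2real_positive_iff)
  qed
  have "\<forall>\<^sub>F j in sequentially. 1 / 2 ^ j \<le> \<delta> \<and> 2 powr (- (real j * e)) \<le> c
      \<and> real (card (dyadic_meeting I j)) \<le> 2 powr (real j * (d + e))"
  proof (intro eventually_conj)
    show "\<forall>\<^sub>F j in sequentially. 2 powr (- (real j * e)) \<le> c"
    proof -
      have "(\<lambda>j. (2 powr (- e)) ^ j) \<longlonglongrightarrow> 0"
        using e(1) by (intro LIMSEQ_power_zero) (simp add: powr_less_one)
      then have "\<forall>\<^sub>F j in sequentially. (2 powr (- e)) ^ j < c"
        using c(1) by (rule order_tendstoD)
      then show ?thesis by eventually_elim (simp add: powr_power mult_ac)
    qed
    show "\<forall>\<^sub>F j in sequentially. real (card (dyadic_meeting I j)) \<le> 2 powr (real j * (d + e))"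
      using assms(3) e(1) bd by (intro eventually_card_dyadic_meeting_le) (auto simp: d_def)
  qed (rule eventually_dyadic_le[OF K(2)])
  then have "\<forall>\<^sub>F l in sequentially. 1 / 2 ^ ?j l \<le> \<delta> \<and> 2 powr (- (real (?j l) * e)) \<le> c
      \<and> real (card (dyadic_meeting I (?j l))) \<le> 2 powr (real (?j l) * (d + e))"
    by (rule eventually_compose_filterlim[OF _ filterlim_geom_scale[OF b(1)]])
  then obtain l1 where l1: "\<And>l. l1 \<le> l \<Longrightarrow> 1 / 2 ^ ?j l \<le> \<delta>"
      "\<And>l. l1 \<le> l \<Longrightarrow> 2 powr (- (real (?j l) * e)) \<le> c"
      "\<And>l. l1 \<le> l \<Longrightarrow> real (card (dyadic_meeting I (?j l))) \<le> 2 powr (real (?j l) * (d + e))"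
    unfolding eventually_sequentially by blast
  \<comment> \<open>The intervals that meet \<open>K\<close> cover it, so their number times
    \<open>2 powr (- j * (d - e))\<close> is at least \<open>c\<close>. For large \<open>j\<close>
    the constant \<open>c\<close> costs only another factor \<open>2 powr (- j * e)\<close>, and
    \<open>2 * e \<le> \<epsilon>\<close>.\<close>
  have lower: "2 powr (real (?j l) * (d - \<epsilon>)) \<le> real (card (?S (?j l)))" if "l1 \<le> l" for l
  proof -
    let ?i = "?j l"
    have fin: "finite (?S ?i)" using finite_dyadic_meeting[OF bd] by simp
    have "K \<subseteq> \<Union>(?S ?i)"
    proof
      fix x assume "x \<in> K"
      moreover obtain Q where "Q \<in> dyadic_intervals ?i" "x \<in> Q" using dyadic_intervals_cover by blast
      ultimately show "x \<in> \<Union>(?S ?i)" using K(1) by (auto simp: dyadic_meeting_def)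
    qed
    then have "ennreal c \<le> hausdorff_content (d - e) \<delta> (\<Union>(?S ?i))"
      using c(2) hausdorff_content_mono order_trans by blast
    also have "\<dots> \<le> ennreal (real (card (?S ?i)) * (1 / 2 ^ ?i) powr (d - e))"
      using l1(1)[OF that] K(2)
      by (intro hausdorff_content_Union_le fin)
        (auto simp: dyadic_meeting_def diameter_dyadic_intervals bounded_dyadic_intervals)
    finally have "c \<le> real (card (?S ?i)) * 2 powr (- (real ?i * (d - e)))"
      by (simp add: powr_inverse_power_2)
    then have "c * 2 powr (real ?i * (d - e)) \<le> real (card (?S ?i))"
      unfolding powr_minus divide_inverse[symmetric] by (subst (asm) pos_le_divide_eq) simp_all
    moreover have "2 powr (real ?i * (d - \<epsilon>)) \<le> 2 powr (- (real ?i * e) + real ?i * (d - e))"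
      using mult_left_mono[OF e(3), of "real ?i"] by (intro powr_mono) (auto simp: algebra_simps)
    moreover have "2 powr (- (real ?i * e)) * 2 powr (real ?i * (d - e)) \<le> c * 2 powr (real ?i * (d - e))"
      using l1(2)[OF that] by (intro mult_right_mono) auto
    ultimately show ?thesis unfolding powr_add by linarith
  qed
  have upper: "real (card (?S (?j l))) \<le> 2 powr (real (?j l) * (d + \<epsilon>))" if "l1 \<le> l" for l
  proof -
    have "card (?S (?j l)) \<le> card (dyadic_meeting I (?j l))"
      using finite_dyadic_meeting[OF bd] by (intro card_mono) auto
    moreover have "2 powr (real (?j l) * (d + e)) \<le> 2 powr (real (?j l) * (d + \<epsilon>))"
      using e by (intro powr_mono mult_left_mono) auto
    ultimately show ?thesis using l1(3)[OF that] by linarith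
  qed
  have descendants: "2 powr (((1 + b) ^ n - 1) * ((1 + b) ^ l * real 1) * (d - 5 * \<epsilon> / b))
      \<le> real (card {R \<in> dyadic_meeting I (?j (l + n)). R \<subseteq> Q \<and> R \<inter> K \<noteq> {}})"
    if "l0 \<le> l" "Q \<in> dyadic_meeting I (?j l)" "Q \<inter> K \<noteq> {}" for l n Q
  proof -
    have "1 \<le> (1 + b) ^ n" using b by simp
    moreover have "5 * e / b \<le> 5 * \<epsilon> / b" using e b by (intro divide_right_mono) auto
    \<comment> \<open>The factor in front is nonnegative, so replacing \<epsilon> by the smaller
      \<open>e\<close> is harmless whatever the sign of
      \<open>d - 5 * \<epsilon> / b\<close>.\<close>
    ultimately have "((1 + b) ^ n - 1) * ((1 + b) ^ l * real 1) * (d - 5 * \<epsilon> / b)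
        \<le> ((1 + b) ^ n - 1) * ((1 + b) ^ l * real 1) * (d - 5 * e / b)"
      using b by (intro mult_left_mono) auto
    also have "\<dots> = (1 + b) ^ (l + n) * (d - 5 * e / b) - (1 + b) ^ l * (d - 5 * e / b)"
      by (simp add: power_add algebra_simps)
    finally have "2 powr (((1 + b) ^ n - 1) * ((1 + b) ^ l * real 1) * (d - 5 * \<epsilon> / b))
        \<le> 2 powr ((1 + b) ^ (l + n) * (d - 5 * e / b) - (1 + b) ^ l * (d - 5 * e / b))"
      by (intro powr_mono) auto
    also have "\<dots> \<le> real (card {R \<in> dyadic_meeting I (?j (l + n)). R \<subseteq> Q \<and> R \<inter> K \<noteq> {}})"
      by (rule card_descendants_ge[where e = "\<lambda>l. (1 + b) ^ l * (d - 5 * e / b)", OF bd step[rule_format] that])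
    finally show ?thesis .
  qed
  have "d - \<epsilon> \<le> hausdorff_dim K"
    using hausdorff_dim_ge_of_content_pos[OF K(2,3,4)] e by linarith
  moreover have "hausdorff_dim K \<le> d"
    unfolding d_def by (rule hausdorff_dim_mono) (rule K(1))
  ultimately show ?thesis
    using K(1) lower upper descendants unfolding d_def[symmetric] Let_def
    by (intro exI[of _ K] exI[of _ "1::nat"] exI[of _ "max l0 l1"]) auto
qed

end
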